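(* Let $n\ge 2$ and let $\mathcal{P}$ be a consistent path system on $[n]$. Then the set system $$\mathcal{F}_{\mathcal{P}}=\{V(P):P\in\mathcal{P}\}\cup\{\emptyset,\{1\},\dots,\{n\}\}\subseteq 2^{[n]}$$ is an intersection-closed maximum class of VC dimension $2$.
   Context: $[n]=\{1,\dots,n\}$. A consistent path system on $[n]$ is a collection $\mathcal{P}$ of simple paths in the complete graph on $[n]$ such that: (i) for every pair of distinct $u,v\in[n]$ there is exactly one path in $\mathcal{P}$ with end vertices $u,v$, denoted $P_{u,v}=P_{v,u}$; (ii) the non-empty intersection of any two paths in $\mathcal{P}$ is either a single vertex or a path in $\mathcal{P}$. $V(P)$ is the vertex set of $P$. A family $\mathcal{F}\subseteq 2^{[n]}$ shatters $S\subseteq[n]$ if $\{S\cap F: F\in\mathcal{F}\}=2^S$. The VC dimension of $\mathcal{F}$ is the maximum cardinality of a set shattered by $\mathcal{F}$. A family $\mathcal{F}\subseteq 2^{[n]}$ of VC dimension $d$ is a maximum class if $|\mathcal{F}|=\sum_{i=0}^{d}\binom{n}{i}$. A family is intersection-closed if $F\cap F'\in\mathcal{F}$ for all $F,F'\in\mathcal{F}$. *)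

theory Defs
  imports Main
begin

datatype 'a graph = Graph (verts: "'a set") (edges: "'a set set")

definition graph_inter :: "'a graph \<Rightarrow> 'a graph \<Rightarrow> 'a graph" where
  "graph_inter G H = Graph (verts G \<inter> verts H) (edges G \<inter> edges H)"

(* Paths are undirected subgraphs: a vertex sequence and its reversal give the same path. *)
definition path_graph :: "'a list \<Rightarrow> 'a graph" where
  "path_graph xs = Graph (set xs) {{xs ! i, xs ! Suc i} | i. Suc i < length xs}"

(* One-vertex paths are allowed here; a path system may or may not contain some of them. *)
definition simple_path_on :: "'a set \<Rightarrow> 'a graph \<Rightarrow> bool" where
  "simple_path_on A P \<longleftrightarrow>
     (\<exists>xs. xs \<noteq> [] \<and> distinct xs \<and> set xs \<subseteq> A \<and> P = path_graph xs)"

definition has_end_vertices :: "'a graph \<Rightarrow> 'a \<Rightarrow> 'a \<Rightarrow> bool" where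
  "has_end_vertices P u v \<longleftrightarrow>
     (\<exists>xs. xs \<noteq> [] \<and> distinct xs \<and> P = path_graph xs \<and> hd xs = u \<and> last xs = v)"

definition consistent_path_system :: "nat \<Rightarrow> nat graph set \<Rightarrow> bool" where
  "consistent_path_system n \<P> \<longleftrightarrow>
     (\<forall>P\<in>\<P>. simple_path_on {1..n} P) \<and>
     (\<forall>u\<in>{1..n}. \<forall>v\<in>{1..n}. u \<noteq> v \<longrightarrow> (\<exists>!P. P \<in> \<P> \<and> has_end_vertices P u v)) \<and>
     (\<forall>P\<in>\<P>. \<forall>Q\<in>\<P>. verts (graph_inter P Q) \<noteq> {} \<longrightarrow>
        (\<exists>v. graph_inter P Q = Graph {v} {}) \<or> graph_inter P Q \<in> \<P>)"

definition path_set_system :: "nat \<Rightarrow> nat graph set \<Rightarrow> nat set set" where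
  "path_set_system n \<P> = verts ` \<P> \<union> ({{}} \<union> {{i} | i. i \<in> {1..n}})"

definition shatters :: "'a set set \<Rightarrow> 'a set \<Rightarrow> bool" where
  "shatters \<F> S \<longleftrightarrow> {S \<inter> F | F. F \<in> \<F>} = Pow S"

(* A relation rather than a function, since the empty family shatters nothing
   and so has no VC dimension. *)
definition has_VC_dim :: "nat \<Rightarrow> nat set set \<Rightarrow> nat \<Rightarrow> bool" where
  "has_VC_dim n \<F> d \<longleftrightarrow>
     (\<exists>S. S \<subseteq> {1..n} \<and> shatters \<F> S \<and> card S = d) \<and>
     (\<forall>S. S \<subseteq> {1..n} \<and> shatters \<F> S \<longrightarrow> card S \<le> d)"

definition maximum_class :: "nat \<Rightarrow> nat set set \<Rightarrow> nat \<Rightarrow> bool" where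
  "maximum_class n \<F> d \<longleftrightarrow>
     \<F> \<subseteq> Pow {1..n} \<and> has_VC_dim n \<F> d \<and> card \<F> = (\<Sum>i=0..d. n choose i)"

definition intersection_closed :: "'a set set \<Rightarrow> bool" where
  "intersection_closed \<F> \<longleftrightarrow> (\<forall>F\<in>\<F>. \<forall>F'\<in>\<F>. F \<inter> F' \<in> \<F>)"

end

theory Submission
  imports Defs
begin

text \<open>
  Intersection-closure is a direct reading of consistency: two members of \<open>\<P>\<close> meet in nothing,
  in a vertex, or in a member of \<open>\<P>\<close>.  The other two claims rest on the fact that a path
  contained as a subgraph in another path is a segment of it.

  \<^item> The size. A path with at least two vertices is recovered from its two leaves
    (\<open>leaves_path_graph\<close>), and \<open>\<P>\<close> contains exactly one path for each pair, so \<open>\<P>\<close> has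
    \<open>n choose 2\<close> nontrivial members (\<open>bij_betw_leaves\<close>). Distinct ones have distinct vertex
    sets (\<open>inj_on_verts\<close>): if \<open>P\<close> and \<open>Q\<close> have the same vertices, then their intersection is a
    path on all those vertices, so it has as many edges as each of them and coincides with both.
    Adding the empty set and the \<open>n\<close> singletons gives \<open>1 + n + (n choose 2)\<close>.

  \<^item> The dimension. Any pair is shattered, by the path joining it. If a set with three elements
    were shattered, some path \<open>P\<close> would contain all three, with \<open>b\<close> between \<open>a\<close> and \<open>c\<close>, say,
    and some path \<open>Q\<close> would contain \<open>a\<close> and \<open>c\<close> but not \<open>b\<close>. The intersection of \<open>P\<close> and \<open>Q\<close>
    would be a path inside \<open>P\<close> joining \<open>a\<close> to \<open>c\<close> and avoiding \<open>b\<close>, which is impossible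
    (\<open>subpath_no_gap\<close>).
\<close>

section \<open>Paths as graphs\<close>

lemma verts_path_graph [simp]: "verts (path_graph xs) = set xs"
  by (simp add: path_graph_def)

lemma edges_path_graph: "edges (path_graph xs) = (\<lambda>i. {xs ! i, xs ! Suc i}) ` {i. Suc i < length xs}"
  by (auto simp: path_graph_def)

lemma path_graph_rev [simp]: "path_graph (rev xs) = path_graph xs"
proof -
  have sub: "edges (path_graph (rev xs)) \<subseteq> edges (path_graph xs)" for xs :: "'a list"
  proof
    fix e assume "e \<in> edges (path_graph (rev xs))"
    then obtain i where i: "Suc i < length xs" "e = {rev xs ! i, rev xs ! Suc i}"
      by (auto simp: edges_path_graph)
    define j where "j = length xs - Suc (Suc i)"
    have "Suc j < length xs" "e = {xs ! j, xs ! Suc j}"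
      using i by (auto simp: j_def rev_nth Suc_diff_Suc)
    then show "e \<in> edges (path_graph xs)"
      by (auto simp: edges_path_graph)
  qed
  have "edges (path_graph (rev xs)) = edges (path_graph xs)"
    using sub[of xs] sub[of "rev xs"] by auto
  then show ?thesis
    by (intro graph.expand) auto
qed

lemma has_end_vertices_sym: "has_end_vertices P u v \<Longrightarrow> has_end_vertices P v u"
  unfolding has_end_vertices_def
  by (metis distinct_rev hd_rev last_rev path_graph_rev rev_is_Nil_conv)

lemma card_edges_path_graph:
  assumes "distinct xs"
  shows "card (edges (path_graph xs)) = length xs - 1"
proof -
  have "inj_on (\<lambda>i. {xs ! i, xs ! Suc i}) {i. Suc i < length xs}"
    using assms by (auto simp: inj_on_def doubleton_eq_iff nth_eq_iff_index_eq)
  moreover have "{i. Suc i < length xs} = {..<length xs - 1}"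
    by auto
  ultimately show ?thesis
    by (simp add: edges_path_graph card_image)
qed

text \<open>A path on \<open>k\<close> vertices has exactly \<open>k - 1\<close> edges, so no path properly contains another
  one on the same vertices.\<close>

lemma spanning_subpath_eq:
  assumes "distinct xs" "distinct zs" "set zs = set xs"
    and "edges (path_graph zs) \<subseteq> edges (path_graph xs)"
  shows "path_graph zs = path_graph xs"
proof -
  have "length zs = length xs"
    using assms(1-3) by (metis distinct_card)
  moreover have "finite (edges (path_graph xs))"
    unfolding edges_path_graph by (rule finite_imageI, rule finite_subset[of _ "{..<length xs}"]) auto
  ultimately have "edges (path_graph zs) = edges (path_graph xs)"
    using assms by (intro card_subset_eq) (simp_all add: card_edges_path_graph)
  then show ?thesis
    using assms(3) by (intro graph.expand) auto
qed

text \<open>Deleting \<open>xs ! j\<close> disconnects a path at \<open>j\<close>, so a walk along its edges that avoids this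
  vertex and starts before it never gets past it.\<close>

lemma walk_stays_before_cut:
  assumes "distinct xs" "j < length xs" "xs ! j \<notin> set zs"
    and sub: "edges (path_graph zs) \<subseteq> edges (path_graph xs)"
    and "k < length zs"
  shows "zs ! k \<in> set (take j xs) \<longleftrightarrow> zs ! 0 \<in> set (take j xs)"
  using \<open>k < length zs\<close>
proof (induction k)
  case (Suc k)
  have "{zs ! k, zs ! Suc k} \<in> edges (path_graph xs)"
    using Suc.prems sub by (auto simp: edges_path_graph)
  then obtain i where i: "Suc i < length xs" "{zs ! k, zs ! Suc k} = {xs ! i, xs ! Suc i}"
    by (auto simp: edges_path_graph)
  have take_iff: "xs ! m \<in> set (take j xs) \<longleftrightarrow> m < j" if "m < length xs" for m
    using that assms(1,2) by (auto simp: in_set_conv_nth nth_eq_iff_index_eq)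
  have "zs ! k \<in> set zs" "zs ! Suc k \<in> set zs"
    using Suc.prems by auto
  then have "i \<noteq> j" "Suc i \<noteq> j"
    using i(2) assms(3) by (metis doubleton_eq_iff)+
  then have "zs ! Suc k \<in> set (take j xs) \<longleftrightarrow> zs ! k \<in> set (take j xs)"
    using i take_iff[of i] take_iff[of "Suc i"] by (auto simp: doubleton_eq_iff)
  then show ?case
    using Suc by simp
qed simp

lemma subpath_no_gap:
  assumes "distinct xs" "edges (path_graph zs) \<subseteq> edges (path_graph xs)"
    and "i < j" "j < k" "k < length xs" "xs ! i \<in> set zs" "xs ! k \<in> set zs"
  shows "xs ! j \<in> set zs"
proof (rule ccontr)
  assume *: "xs ! j \<notin> set zs"
  obtain p q where "p < length zs" "q < length zs" "zs ! p = xs ! i" "zs ! q = xs ! k"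
    using assms(6,7) by (auto simp: in_set_conv_nth)
  then have "xs ! i \<in> set (take j xs) \<longleftrightarrow> xs ! k \<in> set (take j xs)"
    using walk_stays_before_cut[OF assms(1) _ * assms(2)] assms(3-5)
    by (metis less_trans)
  then show False
    using assms(1,3-5) by (auto simp: in_set_conv_nth nth_eq_iff_index_eq)
qed

definition leaves :: "'a graph \<Rightarrow> 'a set" where
  "leaves G = {v. \<exists>!e. e \<in> edges G \<and> v \<in> e}"

text \<open>The ends of a path are read off from its edges, so they do not depend on the vertex
  sequence that represents it.\<close>

lemma leaves_path_graph:
  assumes "distinct xs" "length xs \<ge> 2"
  shows "leaves (path_graph xs) = {hd xs, last xs}"
proof -
  let ?e = "\<lambda>i. {xs ! i, xs ! Suc i}"
  have mem: "xs ! m \<in> ?e i \<longleftrightarrow> m = i \<or> m = Suc i" if "m < length xs" "Suc i < length xs" for m i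
    using that assms(1) by (auto simp: nth_eq_iff_index_eq)
  have leaf: "xs ! m \<in> leaves (path_graph xs) \<longleftrightarrow> m = 0 \<or> m = length xs - 1" if m: "m < length xs" for m
  proof (cases "m = 0 \<or> m = length xs - 1")
    case True
    define i where "i = (if m = 0 then 0 else m - 1)"
    have "Suc i < length xs" "\<And>i'. Suc i' < length xs \<Longrightarrow> xs ! m \<in> ?e i' \<longleftrightarrow> i' = i"
      using True assms(2) m by (auto simp: i_def mem simp del: insert_iff)
    then have "\<exists>!e. e \<in> edges (path_graph xs) \<and> xs ! m \<in> e"
      by (intro ex1I[of _ "?e i"]) (auto simp: edges_path_graph simp del: insert_iff)
    with True show ?thesis
      by (simp add: leaves_def)
  next
    case False
    have *: "?e (m - 1) \<in> edges (path_graph xs)" "?e m \<in> edges (path_graph xs)"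
      "xs ! m \<in> ?e (m - 1)" "xs ! m \<in> ?e m"
      using False m by (auto simp: edges_path_graph)
    moreover have "?e (m - 1) \<noteq> ?e m"
      using False m assms(1) by (auto simp: doubleton_eq_iff nth_eq_iff_index_eq)
    ultimately have "xs ! m \<notin> leaves (path_graph xs)"
      unfolding leaves_def by blast
    with False show ?thesis
      by simp
  qed
  have "leaves (path_graph xs) \<subseteq> set xs"
  proof
    fix v assume "v \<in> leaves (path_graph xs)"
    then obtain e where "e \<in> edges (path_graph xs)" "v \<in> e"
      unfolding leaves_def by blast
    then show "v \<in> set xs"
      by (auto simp: edges_path_graph)
  qed
  moreover have "xs \<noteq> []"
    using assms(2) by auto
  moreover from this have "hd xs = xs ! 0" "last xs = xs ! (length xs - 1)"
    by (simp_all add: hd_conv_nth last_conv_nth)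
  moreover have "v \<in> leaves (path_graph xs) \<longleftrightarrow> v = xs ! 0 \<or> v = xs ! (length xs - 1)"
    if v: "v \<in> set xs" for v
  proof -
    obtain m where m: "m < length xs" "v = xs ! m"
      using v by (auto simp: in_set_conv_nth)
    have "0 < length xs" "length xs - 1 < length xs"
      using m(1) by linarith+
    then show ?thesis
      using leaf[OF m(1)] m assms(1) by (simp add: nth_eq_iff_index_eq)
  qed
  ultimately show ?thesis
    using hd_in_set[of xs] last_in_set[of xs] by auto
qed

section \<open>Consistent path systems\<close>

locale path_system =
  fixes n :: nat and \<P> :: "nat graph set"
  assumes consistent: "consistent_path_system n \<P>"
begin

lemma path_repr:
  assumes "P \<in> \<P>"
  obtains xs where "xs \<noteq> []" "distinct xs" "set xs \<subseteq> {1..n}" "P = path_graph xs"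
  using consistent assms unfolding consistent_path_system_def simple_path_on_def by meson

lemma path_ex1:
  assumes "u \<in> {1..n}" "v \<in> {1..n}" "u \<noteq> v"
  shows "\<exists>!P. P \<in> \<P> \<and> has_end_vertices P u v"
  using consistent assms unfolding consistent_path_system_def by simp

lemma inter_path:
  assumes "P \<in> \<P>" "Q \<in> \<P>" "verts P \<inter> verts Q \<noteq> {}"
  shows "(\<exists>v. graph_inter P Q = Graph {v} {}) \<or> graph_inter P Q \<in> \<P>"
  using consistent assms unfolding consistent_path_system_def
  by (simp add: graph_inter_def)

lemma inter_path_repr:
  assumes "P \<in> \<P>" "Q \<in> \<P>" "a \<in> verts P \<inter> verts Q" "b \<in> verts P \<inter> verts Q" "a \<noteq> b"
  obtains zs where "distinct zs" "graph_inter P Q = path_graph zs"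
    "set zs = verts P \<inter> verts Q" "edges (path_graph zs) \<subseteq> edges P \<inter> edges Q"
proof -
  have vi: "verts (graph_inter P Q) = verts P \<inter> verts Q"
    and ei: "edges (graph_inter P Q) = edges P \<inter> edges Q"
    by (auto simp: graph_inter_def)
  have "graph_inter P Q \<in> \<P>"
  proof (rule ccontr)
    assume "graph_inter P Q \<notin> \<P>"
    then obtain v where "graph_inter P Q = Graph {v} {}"
      using inter_path[OF assms(1,2)] assms(3) by blast
    then show False
      using vi assms(3-5) by (metis graph.sel(1) singletonD)
  qed
  then obtain zs where "distinct zs" "graph_inter P Q = path_graph zs"
    by (rule path_repr)
  with that vi ei show thesis
    by (metis order_refl verts_path_graph)
qed

definition nontrivial :: "nat graph set" where
  "nontrivial = {P \<in> \<P>. card (verts P) \<ge> 2}"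

lemma nontrivial_repr:
  assumes "P \<in> nontrivial"
  obtains xs where "distinct xs" "length xs \<ge> 2" "set xs \<subseteq> {1..n}" "P = path_graph xs"
proof -
  obtain xs where "distinct xs" "set xs \<subseteq> {1..n}" "P = path_graph xs"
    using assms by (auto simp: nontrivial_def elim: path_repr)
  moreover from this have "length xs \<ge> 2"
    using assms by (simp add: nontrivial_def distinct_card)
  ultimately show thesis
    using that by blast
qed

lemma inj_on_verts: "inj_on verts nontrivial"
proof (rule inj_onI)
  fix P Q assume PQ: "P \<in> nontrivial" "Q \<in> nontrivial" "verts P = verts Q"
  obtain xs where xs: "distinct xs" "length xs \<ge> 2" "P = path_graph xs"
    using PQ(1) by (rule nontrivial_repr)
  obtain ys where ys: "distinct ys" "Q = path_graph ys"
    using PQ(2) by (rule nontrivial_repr)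
  have "xs ! 0 \<noteq> xs ! 1" "xs ! 0 \<in> set xs" "xs ! 1 \<in> set xs"
    using xs(1,2) by (simp_all add: nth_eq_iff_index_eq Suc_le_eq flip: One_nat_def length_greater_0_conv)
  then obtain zs where zs: "distinct zs" "set zs = verts P \<inter> verts Q"
    "edges (path_graph zs) \<subseteq> edges P \<inter> edges Q"
    using inter_path_repr[of P Q "xs ! 0" "xs ! 1"] PQ xs(3)
    unfolding nontrivial_def by (metis (lifting) IntI mem_Collect_eq verts_path_graph)
  have "path_graph zs = path_graph xs" "path_graph zs = path_graph ys"
    using zs xs ys PQ(3) by (auto intro!: spanning_subpath_eq)
  then show "P = Q"
    using xs ys by simp
qed

lemma bij_betw_leaves: "bij_betw leaves nontrivial {S. S \<subseteq> {1..n} \<and> card S = 2}"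
proof -
  have ends: "\<exists>u\<in>{1..n}. \<exists>v\<in>{1..n}. u \<noteq> v \<and> leaves P = {u, v} \<and> has_end_vertices P u v"
    if P: "P \<in> nontrivial" for P
  proof -
    obtain xs where xs: "distinct xs" "length xs \<ge> 2" "set xs \<subseteq> {1..n}" "P = path_graph xs"
      using P by (rule nontrivial_repr)
    then have "xs \<noteq> []"
      by auto
    moreover from this have "hd xs \<noteq> last xs"
      using xs(1,2) by (simp add: hd_conv_nth last_conv_nth nth_eq_iff_index_eq)
    moreover have "hd xs \<in> {1..n}" "last xs \<in> {1..n}"
      using xs(3) \<open>xs \<noteq> []\<close> by (meson hd_in_set last_in_set subsetD)+
    moreover have "has_end_vertices P (hd xs) (last xs)"
      using xs \<open>xs \<noteq> []\<close> unfolding has_end_vertices_def by blast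
    ultimately show ?thesis
      using leaves_path_graph[OF xs(1,2)] xs(4) by blast
  qed
  have "inj_on leaves nontrivial"
  proof (rule inj_onI)
    fix P Q assume PQ: "P \<in> nontrivial" "Q \<in> nontrivial" "leaves P = leaves Q"
    obtain u v where uv: "u \<in> {1..n}" "v \<in> {1..n}" "u \<noteq> v" "leaves P = {u, v}"
      "has_end_vertices P u v"
      using ends[OF PQ(1)] by blast
    have "has_end_vertices Q u v"
      using ends[OF PQ(2)] PQ(3) uv(4) has_end_vertices_sym by (metis doubleton_eq_iff)
    then show "P = Q"
      using path_ex1[OF uv(1-3)] uv(5) PQ by (auto simp: nontrivial_def)
  qed
  moreover have "leaves ` nontrivial = {S. S \<subseteq> {1..n} \<and> card S = 2}" (is "_ = ?S")
  proof
    show "leaves ` nontrivial \<subseteq> ?S"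
    proof
      fix S assume "S \<in> leaves ` nontrivial"
      then obtain P where "P \<in> nontrivial" "S = leaves P"
        by blast
      then show "S \<in> ?S"
        using ends[of P] by auto
    qed
    show "?S \<subseteq> leaves ` nontrivial"
    proof
      fix S assume "S \<in> ?S"
      then obtain u v where uv: "u \<in> {1..n}" "v \<in> {1..n}" "u \<noteq> v" "S = {u, v}"
        by (auto simp: card_2_iff)
      then obtain P where P: "P \<in> \<P>" "has_end_vertices P u v"
        using path_ex1 by blast
      then obtain xs where xs: "xs \<noteq> []" "distinct xs" "P = path_graph xs" "hd xs = u" "last xs = v"
        by (auto simp: has_end_vertices_def)
      have "length xs \<noteq> 1"
        using xs(4,5) uv(3) by (auto simp: length_Suc_conv)
      moreover have "length xs \<noteq> 0"
        using xs(1) by simp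
      ultimately have len: "length xs \<ge> 2"
        by linarith
      then have "P \<in> nontrivial"
        using P xs by (simp add: nontrivial_def distinct_card)
      moreover have "leaves P = S"
        using leaves_path_graph[OF xs(2) len] xs uv by simp
      ultimately show "S \<in> leaves ` nontrivial"
        by blast
    qed
  qed
  ultimately show ?thesis
    by (simp add: bij_betw_def)
qed

lemma verts_subset: "P \<in> \<P> \<Longrightarrow> verts P \<subseteq> {1..n}"
  by (elim path_repr) auto

lemma path_set_system_subset: "path_set_system n \<P> \<subseteq> Pow {1..n}"
  using verts_subset by (auto simp: path_set_system_def)

lemma intersection_closed_path_set_system: "intersection_closed (path_set_system n \<P>)"
proof -
  let ?F = "path_set_system n \<P>"
  have small: "A \<in> ?F" if "A \<subseteq> {i}" "A \<subseteq> {1..n}" for A i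
  proof -
    have "A = {} \<or> A = {i}"
      using that(1) by blast
    then show ?thesis
      using that(2) by (auto simp: path_set_system_def)
  qed
  have paths: "verts P \<inter> verts Q \<in> ?F" if PQ: "P \<in> \<P>" "Q \<in> \<P>" for P Q
  proof (cases "verts P \<inter> verts Q = {}")
    case True
    then show ?thesis
      by (simp add: path_set_system_def)
  next
    case False
    have eq: "verts (graph_inter P Q) = verts P \<inter> verts Q"
      by (simp add: graph_inter_def)
    from inter_path[OF PQ False] show ?thesis
    proof
      assume "\<exists>v. graph_inter P Q = Graph {v} {}"
      then obtain v where "verts P \<inter> verts Q = {v}"
        using eq by (metis graph.sel(1))
      moreover have "verts P \<inter> verts Q \<subseteq> {1..n}"
        using verts_subset PQ by blast
      ultimately show ?thesis
        using small[of _ v] by auto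
    next
      assume "graph_inter P Q \<in> \<P>"
      then show ?thesis
        using eq by (auto simp: path_set_system_def)
    qed
  qed
  show ?thesis
    unfolding intersection_closed_def
  proof (intro ballI)
    fix F F' assume F: "F \<in> ?F" "F' \<in> ?F"
    then have sub: "F \<inter> F' \<subseteq> {1..n}"
      using path_set_system_subset by blast
    consider "F \<in> verts ` \<P>" "F' \<in> verts ` \<P>" | i where "F \<inter> F' \<subseteq> {i}"
      using F unfolding path_set_system_def by blast
    then show "F \<inter> F' \<in> ?F"
      by cases (use paths small sub in auto)
  qed
qed

lemma path_set_system_split:
  "path_set_system n \<P> = ({{}} \<union> (\<lambda>i. {i}) ` {1..n}) \<union> verts ` nontrivial"
proof -
  have "verts P \<in> {{}} \<union> (\<lambda>i. {i}) ` {1..n}" if "P \<in> \<P>" "P \<notin> nontrivial" for P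
  proof -
    have "card (verts P) \<le> Suc 0" "finite (verts P)"
      using that finite_subset[OF verts_subset] by (auto simp: nontrivial_def)
    then have "verts P = {} \<or> (\<exists>v. verts P = {v})"
      by (auto simp: le_Suc_eq card_1_singleton_iff)
    then show ?thesis
      using verts_subset[OF that(1)] by auto
  qed
  moreover have "nontrivial \<subseteq> \<P>"
    by (auto simp: nontrivial_def)
  ultimately show ?thesis
    unfolding path_set_system_def by blast
qed

lemma card_path_set_system: "card (path_set_system n \<P>) = 1 + n + (n choose 2)"
proof -
  let ?T = "{{}} \<union> (\<lambda>i. {i}) ` {1..n}" and ?N = "verts ` nontrivial"
  have "card ?N = card {S. S \<subseteq> {1..n} \<and> card S = 2}"
    using card_image[OF inj_on_verts] bij_betw_same_card[OF bij_betw_leaves] by simp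
  also have "\<dots> = n choose 2"
    by (simp add: n_subsets)
  finally have "card ?N = n choose 2" .
  moreover have "card ?T = 1 + n"
    by (subst card_Un_disjoint) (auto simp: card_image)
  moreover have "card A \<le> 1" if "A \<in> ?T" for A
    using that by auto
  then have "?T \<inter> ?N = {}"
    by (fastforce simp: nontrivial_def)
  moreover have "finite ?T" "finite ?N"
    using finite_subset[OF path_set_system_subset] by (auto simp: path_set_system_split)
  ultimately show ?thesis
    unfolding path_set_system_split by (metis card_Un_disjoint)
qed

section \<open>The VC dimension\<close>

lemma shatters_iff: "shatters \<F> S \<longleftrightarrow> (\<forall>T\<subseteq>S. \<exists>F\<in>\<F>. S \<inter> F = T)"
proof -
  have "shatters \<F> S \<longleftrightarrow> Pow S \<subseteq> {S \<inter> F | F. F \<in> \<F>}"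
    unfolding shatters_def by (rule iffI, simp, rule antisym) blast+
  also have "\<dots> \<longleftrightarrow> (\<forall>T\<subseteq>S. \<exists>F. T = S \<inter> F \<and> F \<in> \<F>)"
    unfolding subset_iff[of "Pow S"] Pow_iff mem_Collect_eq by (rule refl)
  also have "\<dots> \<longleftrightarrow> (\<forall>T\<subseteq>S. \<exists>F\<in>\<F>. S \<inter> F = T)"
    by metis
  finally show ?thesis .
qed

lemma shatters_pair:
  assumes "u \<in> {1..n}" "v \<in> {1..n}" "u \<noteq> v"
  shows "shatters (path_set_system n \<P>) {u, v}"
  unfolding shatters_iff
proof (intro allI impI)
  fix T assume "T \<subseteq> {u, v}"
  then consider "T = {}" | "T = {u}" | "T = {v}" | "T = {u, v}"
    by blast
  then show "\<exists>F\<in>path_set_system n \<P>. {u, v} \<inter> F = T"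
  proof cases
    case 4
    obtain P where P: "P \<in> \<P>" "has_end_vertices P u v"
      using path_ex1[OF assms] by blast
    then have "u \<in> verts P" "v \<in> verts P"
      by (auto simp: has_end_vertices_def)
    with 4 P(1) show ?thesis
      by (intro bexI[of _ "verts P"]) (auto simp: path_set_system_def)
  next
    case 1
    then show ?thesis
      by (intro bexI[of _ T]) (auto simp: path_set_system_def)
  qed (use assms in \<open>auto simp: path_set_system_def intro!: bexI[of _ T]\<close>)
qed

lemma path_of_member:
  assumes "F \<in> path_set_system n \<P>" "a \<in> F" "b \<in> F" "a \<noteq> b"
  obtains P where "P \<in> \<P>" "F = verts P"
  using assms by (auto simp: path_set_system_def)

text \<open>One of three vertices on a path separates the other two: \<open>xs ! j\<close> is the vertex to which
  \<open>subpath_no_gap\<close> will be applied.\<close>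

lemma ordered_on_path:
  assumes "card T = 3" "T \<subseteq> set xs"
  obtains i j k where "i < j" "j < k" "k < length xs" "xs ! i \<in> T" "xs ! j \<in> T" "xs ! k \<in> T"
proof -
  obtain a b c where T: "T = {a, b, c}" "a \<noteq> b" "b \<noteq> c" "a \<noteq> c"
    using assms(1) by (auto simp: card_3_iff)
  then obtain p q r where pqr: "p < length xs" "q < length xs" "r < length xs"
    "xs ! p = a" "xs ! q = b" "xs ! r = c"
    using assms(2) by (auto simp: in_set_conv_nth)
  then have "p \<noteq> q" "q \<noteq> r" "p \<noteq> r"
    using T by auto
  then consider "p < q \<and> q < r" | "p < r \<and> r < q" | "q < p \<and> p < r" | "q < r \<and> r < p"
    | "r < p \<and> p < q" | "r < q \<and> q < p"
    by linarith
  then show thesis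
    by cases (use that pqr T(1) in blast)+
qed

lemma shattered_card_le_2:
  assumes "shatters (path_set_system n \<P>) S"
  shows "card S \<le> 2"
proof (rule ccontr)
  assume "\<not> card S \<le> 2"
  then obtain T where T: "T \<subseteq> S" "card T = 3"
    using obtain_subset_with_card_n[of 3 S] by force
  have "\<exists>F\<in>path_set_system n \<P>. T \<inter> F = U" if U: "U \<subseteq> T" for U
  proof -
    obtain F where "F \<in> path_set_system n \<P>" "S \<inter> F = U"
      using assms U T(1) unfolding shatters_iff by (metis order_trans)
    then show ?thesis
      using U T(1) by blast
  qed
  note trace = this
  obtain F where F: "F \<in> path_set_system n \<P>" "T \<subseteq> F"
    using trace[of T] by blast
  obtain x y where "x \<in> T" "y \<in> T" "x \<noteq> y"
    using T(2) by (auto simp: card_3_iff)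
  then obtain P where P: "P \<in> \<P>" "F = verts P"
    using F path_of_member by (metis subsetD)
  obtain xs where xs: "distinct xs" "P = path_graph xs"
    using P(1) by (rule path_repr)
  obtain i j k where ijk: "i < j" "j < k" "k < length xs" "xs ! i \<in> T" "xs ! j \<in> T" "xs ! k \<in> T"
    using ordered_on_path[OF T(2), of xs] F(2) P(2) xs(2) by auto
  have ne: "xs ! i \<noteq> xs ! k" "xs ! j \<noteq> xs ! i" "xs ! j \<noteq> xs ! k"
    using ijk xs(1) by (auto simp: nth_eq_iff_index_eq)
  obtain G where G: "G \<in> path_set_system n \<P>" "T \<inter> G = {xs ! i, xs ! k}"
    using trace[of "{xs ! i, xs ! k}"] ijk by auto
  then have mem: "xs ! i \<in> G" "xs ! k \<in> G" "xs ! j \<notin> G"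
    using ijk ne by auto
  then obtain Q where Q: "Q \<in> \<P>" "G = verts Q"
    using G(1) ne(1) path_of_member by metis
  have common: "xs ! i \<in> verts P \<inter> verts Q" "xs ! k \<in> verts P \<inter> verts Q"
    using mem(1,2) ijk(4,6) F(2) P(2) Q(2) by auto
  obtain zs where zs: "set zs = verts P \<inter> verts Q" "edges (path_graph zs) \<subseteq> edges P \<inter> edges Q"
    using P(1) Q(1) common ne(1) by (rule inter_path_repr)
  have "xs ! i \<in> set zs" "xs ! k \<in> set zs"
    using zs(1) common by simp_all
  moreover have "edges (path_graph zs) \<subseteq> edges (path_graph xs)"
    using zs(2) xs(2) by blast
  ultimately have "xs ! j \<in> set zs"
    using subpath_no_gap[OF xs(1) _ ijk(1-3)] by blast
  then show False
    using zs(1) mem(3) Q(2) by simp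
qed

end

theorem mainTheorem8:
  fixes n :: nat and \<P> :: "nat graph set"
  assumes "n \<ge> 2"
    and "consistent_path_system n \<P>"
  shows "intersection_closed (path_set_system n \<P>) \<and>
         maximum_class n (path_set_system n \<P>) 2"
proof -
  interpret path_system n \<P>
    by unfold_locales (rule assms(2))
  have "shatters (path_set_system n \<P>) {1, 2}" "{1, 2} \<subseteq> {1..n}" "card {1, 2 :: nat} = 2"
    using shatters_pair[of 1 2] assms(1) by auto
  then have "has_VC_dim n (path_set_system n \<P>) 2"
    unfolding has_VC_dim_def using shattered_card_le_2 by blast
  moreover have "(\<Sum>i=0..2. n choose i) = 1 + n + (n choose 2)"
    by (simp add: numeral_2_eq_2)
  ultimately show ?thesis
    using intersection_closed_path_set_system path_set_system_subset card_path_set_system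
    by (simp add: maximum_class_def)
qed

end
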